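(* Let $d\ge 1$, let $f:\mathbb{R}^d\to\mathbb{R}$ be a $\mathcal{C}^1$ function, and suppose that $m>0$, $\sigma>0$, $r>0$ and (finite) $L>m$ satisfy $$r<\sigma,\qquad m\ge 2r\sigma,\qquad L\le\frac{(2\sigma-r)m}{r}.$$ If $\nabla f$ belongs to the sector $[m,L]$, then the system $$\dot q = p,\qquad \dot p=-2\sigma p-\nabla f(q)$$ on $\mathbb{R}^{2d}\ni z=(q,p)$ is $r$-exponentially stable.
   Context: Sector: for $m<L<\infty$, a continuous function $\phi:\mathbb{R}^n\to\mathbb{R}^n$ belongs to the sector $[m,L]$ if $\langle mw-\phi(w),\,w-L^{-1}\phi(w)\rangle\le 0$ for all $w\in\mathbb{R}^n$. Exponential stability: an autonomous system $\dot z=F(z)$ with $F$ continuous is $r$-exponentially stable ($r\ge0$) if $z=0$ is an equilibrium point and there is an increasing continuous function $\kappa:[0,\infty)\to[0,\infty)$ with $\kappa(0)=0$ such that $|z(t)|\le\kappa(|z(0)|)\,e^{-rt}$ for each solution $z$ and every $t\ge0$ for which $z$ exists. *)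

theory Defs
  imports "HOL-Analysis.Analysis"
begin

definition gradient :: "('a::real_inner \<Rightarrow> real) \<Rightarrow> 'a \<Rightarrow> 'a"
  where "gradient f x = (THE D. GDERIV f x :> D)"

(* In finite dimension the gradient of a differentiable function always exists,
   and its continuity is that of the partial derivatives. *)
definition C1_function :: "('a::euclidean_space \<Rightarrow> real) \<Rightarrow> bool"
  where "C1_function f \<longleftrightarrow>
    (\<forall>x. f differentiable (at x)) \<and> continuous_on UNIV (gradient f)"

definition in_sector :: "real \<Rightarrow> real \<Rightarrow> ('a::euclidean_space \<Rightarrow> 'a) \<Rightarrow> bool"
  where "in_sector m L \<phi> \<longleftrightarrow>
    m < L \<and> continuous_on UNIV \<phi> \<and>
    (\<forall>w. (m *\<^sub>R w - \<phi> w) \<bullet> (w - inverse L *\<^sub>R \<phi> w) \<le> 0)"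

(* Solutions may live on any nondegenerate interval, open or closed at either end;
   at an endpoint belonging to I the derivative is one-sided. *)
definition is_solution ::
    "('a::euclidean_space \<Rightarrow> 'a) \<Rightarrow> real set \<Rightarrow> (real \<Rightarrow> 'a) \<Rightarrow> bool"
  where "is_solution F I z \<longleftrightarrow>
    is_interval I \<and> interior I \<noteq> {} \<and>
    (\<forall>t\<in>I. (z has_vector_derivative F (z t)) (at t within I))"

(* F is merely continuous, so the bound is required of every solution through every
   initial value; kappa does not depend on the solution. *)
definition exponentially_stable :: "real \<Rightarrow> ('a::euclidean_space \<Rightarrow> 'a) \<Rightarrow> bool"
  where "exponentially_stable r F \<longleftrightarrow>
    0 \<le> r \<and> continuous_on UNIV F \<and> F 0 = 0 \<and>
    (\<exists>\<kappa>::real \<Rightarrow> real.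
      \<kappa> \<in> {0..} \<rightarrow> {0..} \<and> continuous_on {0..} \<kappa> \<and> strict_mono_on {0..} \<kappa> \<and> \<kappa> 0 = 0 \<and>
      (\<forall>I z. is_solution F I z \<longrightarrow> 0 \<in> I \<longrightarrow>
        (\<forall>t\<in>I. 0 \<le> t \<longrightarrow> norm (z t) \<le> \<kappa> (norm (z 0)) * exp (- r * t))))"

definition heavy_ball_field ::
    "real \<Rightarrow> ('a::euclidean_space \<Rightarrow> real) \<Rightarrow> 'a \<times> 'a \<Rightarrow> 'a \<times> 'a"
  where "heavy_ball_field \<sigma> f = (\<lambda>(q, p). (p, - (2 * \<sigma>) *\<^sub>R p - gradient f q))"

end

theory Submission
  imports Defs
begin

text \<open>
  Put \<open>\<tau> = 2\<sigma> - r\<close> and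
  \<open>V(q, p) = (m + 2r(\<sigma> - r))/2 |p|\<^sup>2 + \<tau>m \<langle>p, q\<rangle> + \<sigma>\<tau>m |q|\<^sup>2 + (m - 2r\<sigma>)(f q - f 0)\<close>.
  With \<open>e = \<nabla>f q - m q\<close>, the sector condition gives \<open>r|e|\<^sup>2 \<le> 2(\<sigma> - r)m \<langle>q, e\<rangle>\<close> and
  \<open>f q - f 0 \<le> (L/2)|q|\<^sup>2 \<le> (\<tau>m/2r)|q|\<^sup>2\<close>; since \<open>m - 2r\<sigma> \<ge> 0\<close>, one obtains along solutions
  \<open>V' + 2rV \<le> - (r\<tau>/(2(\<sigma> - r))) |2(\<sigma> - r)p + e|\<^sup>2 \<le> 0\<close>. As \<open>f q - f 0 \<ge> (m/2)|q|\<^sup>2\<close>, \<open>V\<close> is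
  comparable to \<open>|q|\<^sup>2 + |p|\<^sup>2\<close>.
\<close>

section \<open>Existence and uniqueness of the gradient\<close>

lemma GDERIV_gradient:
  fixes f :: "'a::euclidean_space \<Rightarrow> real"
  assumes "f differentiable (at x)"
  shows "GDERIV f x :> gradient f x"
proof -
  obtain f' where f': "(f has_derivative f') (at x)"
    using assms unfolding differentiable_def by blast
  then interpret bounded_linear f'
    by (rule has_derivative_bounded_linear)
  \<comment> \<open>This is the Riesz representative of the linear functional
    \<open>f'\<close>.\<close>
  let ?D = "\<Sum>b\<in>Basis. f' b *\<^sub>R b"
  have "f' h = h \<bullet> ?D" for h
  proof -
    have "f' h = f' (\<Sum>b\<in>Basis. (h \<bullet> b) *\<^sub>R b)"
      by (simp add: euclidean_representation)
    also have "\<dots> = h \<bullet> ?D"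
      by (simp add: sum scaleR inner_sum_right mult.commute)
    finally show ?thesis .
  qed
  then have D: "GDERIV f x :> ?D"
    unfolding gderiv_def by (rule has_derivative_eq_rhs[OF f' ext])
  \<comment> \<open>Uniqueness is required because \<open>gradient\<close> is a definite
    description.\<close>
  have "E = ?D" if "GDERIV f x :> E" for E
  proof -
    have "(\<lambda>h. h \<bullet> E) = (\<lambda>h. h \<bullet> ?D)"
      using that D unfolding gderiv_def by (rule has_derivative_unique)
    then show ?thesis
      by (metis vector_eq_ldot)
  qed
  with D show ?thesis
    unfolding gradient_def by (rule theI)
qed

lemma C1_function_GDERIV:
  "C1_function f \<Longrightarrow> GDERIV f x :> gradient f x"
  by (simp add: C1_function_def GDERIV_gradient)

section \<open>Consequences of the sector condition\<close>

lemma in_sector_defect: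
  fixes \<phi> :: "'a::euclidean_space \<Rightarrow> 'a"
  assumes "in_sector m L \<phi>" "0 < L"
  defines "e \<equiv> \<lambda>w. \<phi> w - m *\<^sub>R w"
  shows "e w \<bullet> e w \<le> (L - m) * (w \<bullet> e w)"
proof -
  have "L * ((m *\<^sub>R w - \<phi> w) \<bullet> (w - inverse L *\<^sub>R \<phi> w)) \<le> 0"
    using assms unfolding in_sector_def by (simp add: mult_nonneg_nonpos)
  \<comment> \<open>The first factor is \<open>- e w\<close>, and L times the second is
    \<open>(L - m) *\<^sub>R w - e w\<close>.\<close>
  also have "L * ((m *\<^sub>R w - \<phi> w) \<bullet> (w - inverse L *\<^sub>R \<phi> w))
    = e w \<bullet> e w - (L - m) * (w \<bullet> e w)"
    using \<open>0 < L\<close> by (simp add: e_def inner_diff inner_commute field_simps)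
  finally show ?thesis by simp
qed

text \<open>Both bounds concern \<open>w \<bullet> e\<close>: it is nonnegative because it dominates
  a multiple of the square of |e|, and Cauchy-Schwarz combined with the defect estimate bounds its
  square by \<open>(L - m) * (w \<bullet> w)\<close> times itself, so one factor cancels.\<close>

lemma in_sector_inner_bounds:
  fixes \<phi> :: "'a::euclidean_space \<Rightarrow> 'a"
  assumes "in_sector m L \<phi>" "0 < L"
  shows "m * (w \<bullet> w) \<le> w \<bullet> \<phi> w" and "w \<bullet> \<phi> w \<le> L * (w \<bullet> w)"
proof -
  define e where "e = \<phi> w - m *\<^sub>R w"
  have e: "e \<bullet> e \<le> (L - m) * (w \<bullet> e)"
    using in_sector_defect[OF assms] by (simp add: e_def)
  have "m < L" using assms by (simp add: in_sector_def)
  have "0 \<le> (L - m) * (w \<bullet> e)"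
    using e inner_ge_zero order_trans by blast
  then have nonneg: "0 \<le> w \<bullet> e"
    using \<open>m < L\<close> by (simp add: zero_le_mult_iff)
  then show "m * (w \<bullet> w) \<le> w \<bullet> \<phi> w"
    by (simp add: e_def inner_diff)
  have "(w \<bullet> e) * (w \<bullet> e) \<le> (w \<bullet> w) * (e \<bullet> e)"
    using Cauchy_Schwarz_ineq[of w e] by (simp add: power2_eq_square)
  also have "\<dots> \<le> (w \<bullet> w) * ((L - m) * (w \<bullet> e))"
    using e by (simp add: mult_left_mono)
  finally have "(w \<bullet> e) * (w \<bullet> e) \<le> ((L - m) * (w \<bullet> w)) * (w \<bullet> e)"
    by (simp add: mult_ac)
  then have "w \<bullet> e \<le> (L - m) * (w \<bullet> w)"
    using nonneg \<open>m < L\<close> by (cases "w \<bullet> e = 0") (auto simp: mult_le_cancel_right)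
  then show "w \<bullet> \<phi> w \<le> L * (w \<bullet> w)"
    by (simp add: e_def inner_diff algebra_simps)
qed

lemma in_sector_zero:
  assumes "in_sector m L \<phi>" "0 < L"
  shows "\<phi> 0 = 0"
  using in_sector_defect[OF assms, of 0] by (simp flip: power2_norm_eq_inner)

section \<open>Quadratic growth of a function from radial bounds on its gradient\<close>

lemma gradient_growth_lower:
  fixes f :: "'a::real_inner \<Rightarrow> real"
  assumes "\<And>x. GDERIV f x :> g x" "\<And>w. m * (w \<bullet> w) \<le> w \<bullet> g w"
  shows "m / 2 * (q \<bullet> q) \<le> f q - f 0"
proof -
  \<comment> \<open>The difference from the comparison parabola along the ray through q. Since m may
    have either sign, the upper bound follows by passing to \<open>- f\<close> and
    \<open>- M\<close>.\<close>
  define \<psi> where "\<psi> t = f (t *\<^sub>R q) - m / 2 * t\<^sup>2 * (q \<bullet> q)" for t :: real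
  have d: "(\<psi> has_real_derivative (q \<bullet> g (t *\<^sub>R q) - m * t * (q \<bullet> q))) (at t)" for t
  proof -
    have "((\<lambda>t. f (t *\<^sub>R q)) has_derivative (\<lambda>h. (h *\<^sub>R q) \<bullet> g (t *\<^sub>R q))) (at t)"
      by (rule has_derivative_compose[OF _ assms(1)[unfolded gderiv_def]])
        (auto intro!: derivative_eq_intros)
    then have "((\<lambda>t. f (t *\<^sub>R q)) has_real_derivative q \<bullet> g (t *\<^sub>R q)) (at t)"
      by (simp add: has_field_derivative_def mult_commute_abs)
    then show ?thesis
      unfolding \<psi>_def[abs_def] by (auto intro!: derivative_eq_intros)
  qed
  have "\<psi> 0 \<le> \<psi> 1"
  proof (rule DERIV_nonneg_imp_increasing_open[of 0 1])
    fix t :: real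
    assume "0 < t" "t < 1"
    \<comment> \<open>The hypothesis at \<open>t *\<^sub>R q\<close> carries an extra factor t,
      which is cancelled because t > 0; hence monotonicity is tested on the open interval
      only.\<close>
    have "t * (m * t * (q \<bullet> q)) \<le> t * (q \<bullet> g (t *\<^sub>R q))"
      using assms(2)[of "t *\<^sub>R q"] by (simp add: mult_ac)
    with \<open>0 < t\<close> have "0 \<le> q \<bullet> g (t *\<^sub>R q) - m * t * (q \<bullet> q)" by simp
    with d show "\<exists>y. (\<psi> has_real_derivative y) (at t) \<and> 0 \<le> y" by blast
  qed (use d in \<open>auto intro!: DERIV_atLeastAtMost_imp_continuous_on\<close>)
  then show ?thesis by (simp add: \<psi>_def)
qed

lemma gradient_growth_upper:
  fixes f :: "'a::real_inner \<Rightarrow> real"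
  assumes "\<And>x. GDERIV f x :> g x" "\<And>w. w \<bullet> g w \<le> M * (w \<bullet> w)"
  shows "f q - f 0 \<le> M / 2 * (q \<bullet> q)"
  using gradient_growth_lower[of "\<lambda>x. - f x" "\<lambda>x. - g x" "- M" q] assms
  by (simp add: GDERIV_minus)

section \<open>Bounds for quadratic forms in two vectors\<close>

lemma binary_form_lower:
  fixes p q :: "'a::real_inner"
  shows "(\<alpha> * \<gamma> - \<beta>\<^sup>2) * (p \<bullet> p + q \<bullet> q)
    \<le> (\<alpha> + \<gamma>) * (\<alpha> * (p \<bullet> p) + 2 * \<beta> * (p \<bullet> q) + \<gamma> * (q \<bullet> q))"
proof -
  \<comment> \<open>Let A be the symmetric matrix with rows (\<alpha>, \<beta>) and (\<beta>,
    \<gamma>). The right side is the form of A^2, and Cayley-Hamilton gives A^2 = (trace A) A - (det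
    A) I.\<close>
  have "0 \<le> (\<alpha> *\<^sub>R p + \<beta> *\<^sub>R q) \<bullet> (\<alpha> *\<^sub>R p + \<beta> *\<^sub>R q) + (\<beta> *\<^sub>R p + \<gamma> *\<^sub>R q) \<bullet> (\<beta> *\<^sub>R p + \<gamma> *\<^sub>R q)"
    by simp
  also have "\<dots> = (\<alpha> + \<gamma>) * (\<alpha> * (p \<bullet> p) + 2 * \<beta> * (p \<bullet> q) + \<gamma> * (q \<bullet> q))
      - (\<alpha> * \<gamma> - \<beta>\<^sup>2) * (p \<bullet> p + q \<bullet> q)"
    by (simp add: inner_add inner_commute algebra_simps power2_eq_square)
  finally show ?thesis by simp
qed

lemma binary_form_upper:
  fixes p q :: "'a::real_inner"
  assumes "0 \<le> \<alpha>" "0 \<le> \<beta>" "0 \<le> \<gamma>"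
  shows "\<alpha> * (p \<bullet> p) + 2 * \<beta> * (p \<bullet> q) + \<gamma> * (q \<bullet> q) \<le> (\<alpha> + \<beta> + \<gamma>) * (p \<bullet> p + q \<bullet> q)"
proof -
  have "0 \<le> \<beta> * ((p - q) \<bullet> (p - q)) + \<alpha> * (q \<bullet> q) + \<gamma> * (p \<bullet> p)"
    using assms by simp
  also have "\<dots> = (\<alpha> + \<beta> + \<gamma>) * (p \<bullet> p + q \<bullet> q)
      - (\<alpha> * (p \<bullet> p) + 2 * \<beta> * (p \<bullet> q) + \<gamma> * (q \<bullet> q))"
    by (simp add: inner_diff inner_commute algebra_simps)
  finally show ?thesis by simp
qed

section \<open>Exponential decay from a differential inequality\<close>

lemma exp_decay:
  fixes v v' :: "real \<Rightarrow> real"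
  assumes "0 \<le> T"
    and deriv: "\<And>t. t \<in> {0..T} \<Longrightarrow> (v has_real_derivative v' t) (at t within {0..T})"
    and le: "\<And>t. t \<in> {0..T} \<Longrightarrow> v' t + k * v t \<le> 0"
  shows "v T \<le> v 0 * exp (- k * T)"
proof -
  \<comment> \<open>With the integrating factor \<open>exp (k * t)\<close> the assumed inequality
    makes the derivative nonpositive. It is put in Frechet form for \<open>mvt_very_simple\<close>,
    which works with one-sided derivatives at the endpoints and allows T = 0.\<close>
  have "((\<lambda>t. exp (k * t) * v t) has_derivative (*) (exp (k * t) * (v' t + k * v t)))
      (at t within {0..T})" if "t \<in> {0..T}" for t
    unfolding has_field_derivative_def[symmetric]
    using deriv[OF that] by (auto intro!: derivative_eq_intros simp: algebra_simps)
  then obtain t where "t \<in> {0..T}"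
    and eq: "exp (k * T) * v T - exp (k * 0) * v 0 = exp (k * t) * (v' t + k * v t) * (T - 0)"
    using mvt_very_simple[OF \<open>0 \<le> T\<close>, of "\<lambda>t. exp (k * t) * v t"
        "\<lambda>t. (*) (exp (k * t) * (v' t + k * v t))"] by auto
  have "exp (k * t) * (v' t + k * v t) * T \<le> 0"
    using le[OF \<open>t \<in> {0..T}\<close>] \<open>0 \<le> T\<close> by (simp add: mult_nonneg_nonpos mult_nonpos_nonneg)
  with eq have "exp (k * T) * v T \<le> v 0" by simp
  then show ?thesis
    by (simp add: exp_minus field_simps)
qed

section \<open>The Lyapunov function and its derivative along curves\<close>

context
  fixes f :: "'a::euclidean_space \<Rightarrow> real" and m \<sigma> r :: real
begin

definition lyapunov :: "'a \<times> 'a \<Rightarrow> real" where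
  "lyapunov = (\<lambda>(q, p). (m + 2 * r * (\<sigma> - r)) / 2 * (p \<bullet> p) + (2 * \<sigma> - r) * m * (p \<bullet> q)
    + \<sigma> * (2 * \<sigma> - r) * m * (q \<bullet> q) + (m - 2 * r * \<sigma>) * (f q - f 0))"

text \<open>The differential of \<open>lyapunov\<close> at the first argument, applied to an
  arbitrary velocity; the equation of motion enters only in
  \<open>lyapunov_dissipation\<close>.\<close>

definition lyapunov_deriv :: "'a \<times> 'a \<Rightarrow> 'a \<times> 'a \<Rightarrow> real" where
  "lyapunov_deriv = (\<lambda>(q, p) (q', p'). (m + 2 * r * (\<sigma> - r)) * (p \<bullet> p')
    + (2 * \<sigma> - r) * m * (p' \<bullet> q + p \<bullet> q')
    + 2 * \<sigma> * (2 * \<sigma> - r) * m * (q \<bullet> q') + (m - 2 * r * \<sigma>) * (q' \<bullet> gradient f q))"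

lemma lyapunov_has_derivative:
  assumes "C1_function f" "(z has_vector_derivative z') (at t within I)"
  shows "((\<lambda>t. lyapunov (z t)) has_real_derivative lyapunov_deriv (z t) z') (at t within I)"
proof -
  obtain q' p' where z': "z' = (q', p')" by fastforce
  have q: "((\<lambda>t. fst (z t)) has_derivative (\<lambda>h. h *\<^sub>R q')) (at t within I)"
    and p: "((\<lambda>t. snd (z t)) has_derivative (\<lambda>h. h *\<^sub>R p')) (at t within I)"
    using has_derivative_fst[OF assms(2)[unfolded has_vector_derivative_def]]
      has_derivative_snd[OF assms(2)[unfolded has_vector_derivative_def]]
    by (simp_all add: z')
  have fq: "((\<lambda>t. f (fst (z t))) has_derivative (\<lambda>h. (h *\<^sub>R q') \<bullet> gradient f (fst (z t)))) (at t within I)"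
    by (rule has_derivative_compose[OF q C1_function_GDERIV[OF assms(1), unfolded gderiv_def]])
  show ?thesis
    unfolding lyapunov_def case_prod_beta has_field_derivative_def
    by (rule has_derivative_eq_rhs, (rule has_derivative_add has_derivative_diff has_derivative_const
          has_derivative_mult_right has_derivative_inner p q fq)+)
      (simp add: fun_eq_iff lyapunov_deriv_def z' case_prod_beta inner_commute field_simps)
qed

section \<open>Dissipation and two-sided quadratic bounds\<close>

context
  fixes L :: real
  assumes C1: "C1_function f"
    and pos: "0 < m" "0 < r" "r < \<sigma>" "m < L"
    and m_ge: "2 * r * \<sigma> \<le> m"
    and L_le: "r * L \<le> (2 * \<sigma> - r) * m"
    and sector: "in_sector m L (gradient f)"
begin

lemma L_pos: "0 < L"
  using pos by simp

lemma potential_bounds: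
  shows "m / 2 * (q \<bullet> q) \<le> f q - f 0" and "f q - f 0 \<le> L / 2 * (q \<bullet> q)"
  by (rule gradient_growth_lower[of f "gradient f"] gradient_growth_upper[of f "gradient f"],
      rule C1_function_GDERIV[OF C1], rule in_sector_inner_bounds[OF sector L_pos])+

lemma lyapunov_dissipation:
  "lyapunov_deriv z (heavy_ball_field \<sigma> f z) + 2 * r * lyapunov z \<le> 0"
proof -
  obtain q p where z: "z = (q, p)" by fastforce
  define g where "g = gradient f q"
  define e where "e = g - m *\<^sub>R q"
  define \<rho> where "\<rho> = \<sigma> - r"
  define \<tau> where "\<tau> = 2 * \<sigma> - r"
  have \<rho>: "0 < \<rho>" and \<tau>: "0 < \<tau>" and \<sigma>: "\<sigma> = \<rho> + r" and \<tau>_eq: "\<tau> = 2 * \<rho> + r"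
    using pos by (simp_all add: \<rho>_def \<tau>_def)
  have e1: "e \<bullet> e \<le> (L - m) * (q \<bullet> e)"
    using in_sector_defect[OF sector L_pos] by (simp add: e_def g_def)
  have qe: "0 \<le> q \<bullet> e"
    using in_sector_inner_bounds(1)[OF sector L_pos, of q] by (simp add: e_def g_def inner_diff)
  \<comment> \<open>First use of the upper bound on L: subtracting r m from both sides of
    \<open>L_le\<close> leaves \<open>2 * \<rho> * m\<close> on the right.\<close>
  have "r * (e \<bullet> e) \<le> (r * L - r * m) * (q \<bullet> e)"
    using e1 pos mult_left_mono[of _ _ r] by (fastforce simp: algebra_simps)
  also have "\<dots> \<le> 2 * \<rho> * m * (q \<bullet> e)"
    using L_le qe by (intro mult_right_mono) (auto simp: \<rho>_def algebra_simps)
  finally have e2: "r * (e \<bullet> e) / (2 * \<rho>) \<le> m * (q \<bullet> e)"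
    using \<rho> by (simp add: field_simps)
  \<comment> \<open>Second use of the upper bound on L, now to control the potential.\<close>
  have "r * (f q - f 0) \<le> r * (L / 2 * (q \<bullet> q))"
    using potential_bounds(2) pos by (intro mult_left_mono) auto
  also have "\<dots> = r * L * ((q \<bullet> q) / 2)" by simp
  also have "\<dots> \<le> \<tau> * m * ((q \<bullet> q) / 2)"
    using L_le by (intro mult_right_mono) (auto simp: \<tau>_def)
  finally have F: "2 * r * (f q - f 0) \<le> \<tau> * m * (q \<bullet> q)" by simp
  \<comment> \<open>After substituting g = m q + e all \<open>p \<bullet> q\<close> terms cancel,
    and the \<open>q \<bullet> q\<close> terms acquire the same factor
    \<open>m - 2 * r * \<sigma>\<close> as the potential.\<close>
  have "lyapunov_deriv z (heavy_ball_field \<sigma> f z) + 2 * r * lyapunov z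
      = - 2 * \<rho> * r * \<tau> * (p \<bullet> p) - 2 * r * \<tau> * (p \<bullet> e) - \<tau> * (m * (q \<bullet> e))
        + (m - 2 * r * \<sigma>) * (2 * r * (f q - f 0) - \<tau> * m * (q \<bullet> q))"
    unfolding z lyapunov_deriv_def lyapunov_def heavy_ball_field_def
    by (simp add: g_def[symmetric] e_def \<sigma> \<tau>_eq inner_diff_right inner_commute algebra_simps power2_eq_square)
  also have "\<dots> \<le> - 2 * \<rho> * r * \<tau> * (p \<bullet> p) - 2 * r * \<tau> * (p \<bullet> e) - \<tau> * (r * (e \<bullet> e) / (2 * \<rho>))"
    using mult_left_mono[OF e2, of \<tau>] \<tau> m_ge F
      mult_nonneg_nonpos[of "m - 2 * r * \<sigma>" "2 * r * (f q - f 0) - \<tau> * m * (q \<bullet> q)"]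
    by linarith
  \<comment> \<open>Completing the square: \<open>e2\<close> supplied exactly the
    \<open>e \<bullet> e\<close> term needed for a perfect square.\<close>
  also have "\<dots> = - (r * \<tau> / (2 * \<rho>)) * (((2 * \<rho>) *\<^sub>R p + e) \<bullet> ((2 * \<rho>) *\<^sub>R p + e))"
    using \<rho> by (simp add: inner_add inner_commute field_simps)
  also have "\<dots> \<le> 0"
    using \<rho> \<tau> pos by (simp add: mult_nonneg_nonneg)
  finally show ?thesis .
qed

text \<open>Replacing the potential by its lower bound \<open>m / 2 * (q \<bullet> q)\<close> leaves
  a quadratic form with coefficients \<alpha>, \<beta>, \<gamma>. It is positive definite, and
  determinant over trace serves as the constant.\<close>

lemma lyapunov_coercive:
  obtains c where "0 < c" "\<And>z. c * (z \<bullet> z) \<le> lyapunov z"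
proof -
  define \<tau> where "\<tau> = 2 * \<sigma> - r"
  define \<alpha> where "\<alpha> = (m + 2 * r * (\<sigma> - r)) / 2"
  define \<beta> where "\<beta> = \<tau> * m / 2"
  define \<gamma> where "\<gamma> = \<sigma> * \<tau> * m + (m - 2 * r * \<sigma>) * m / 2"
  have "0 < \<tau>" using pos by (simp add: \<tau>_def)
  have \<alpha>: "0 < \<alpha>" using pos by (simp add: \<alpha>_def add_pos_pos)
  have "0 < \<gamma>" using pos m_ge \<open>0 < \<tau>\<close> by (simp add: \<gamma>_def add_pos_nonneg)
  have "r * r < 2 * r * \<sigma>" using pos by simp
  then have "r * r < m" using m_ge by linarith
  \<comment> \<open>The identity \<tau>^2 = 4 \<sigma> (\<sigma> - r) + r^2 isolates
    \<open>m - r * r\<close> as the only factor whose sign is not immediate; r < \<sigma> and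
    \<open>m_ge\<close> make it positive.\<close>
  have "\<alpha> * \<gamma> - \<beta>\<^sup>2
      = m / 4 * (m * (m - r * r) + 2 * r * (\<sigma> - r) * m + 8 * r * (\<sigma> - r) * (\<sigma> - r) * \<sigma>)"
    by (simp add: \<alpha>_def \<beta>_def \<gamma>_def \<tau>_def field_simps power2_eq_square)
  also have "\<dots> > 0"
    using pos \<open>r * r < m\<close> by (intro mult_pos_pos add_pos_pos) auto
  finally have disc: "0 < \<alpha> * \<gamma> - \<beta>\<^sup>2" .
  show ?thesis
  proof
    show "0 < (\<alpha> * \<gamma> - \<beta>\<^sup>2) / (\<alpha> + \<gamma>)"
      using disc \<alpha> \<open>0 < \<gamma>\<close> by simp
    fix z :: "'a \<times> 'a"
    obtain q p where z: "z = (q, p)" by fastforce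
    have "(\<alpha> * \<gamma> - \<beta>\<^sup>2) / (\<alpha> + \<gamma>) * (z \<bullet> z)
        \<le> \<alpha> * (p \<bullet> p) + 2 * \<beta> * (p \<bullet> q) + \<gamma> * (q \<bullet> q)"
      using binary_form_lower[of \<alpha> \<gamma> \<beta> p q] \<alpha> \<open>0 < \<gamma>\<close>
      by (simp add: z field_simps)
    also have "\<dots> = \<alpha> * (p \<bullet> p) + 2 * \<beta> * (p \<bullet> q) + \<sigma> * \<tau> * m * (q \<bullet> q)
        + (m - 2 * r * \<sigma>) * (m / 2 * (q \<bullet> q))"
      by (simp add: \<gamma>_def algebra_simps)
    also have "\<dots> \<le> lyapunov z"
      using mult_left_mono[OF potential_bounds(1)[of q], of "m - 2 * r * \<sigma>"] m_ge
      by (simp add: lyapunov_def z \<alpha>_def \<beta>_def \<tau>_def)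
    finally show "(\<alpha> * \<gamma> - \<beta>\<^sup>2) / (\<alpha> + \<gamma>) * (z \<bullet> z) \<le> lyapunov z" .
  qed
qed

text \<open>The potential is now replaced by its upper bound, so L takes the place of m in the
  second summand of \<gamma>.\<close>

lemma lyapunov_bounded:
  obtains K where "0 < K" "\<And>z. lyapunov z \<le> K * (z \<bullet> z)"
proof -
  define \<tau> where "\<tau> = 2 * \<sigma> - r"
  define \<alpha> where "\<alpha> = (m + 2 * r * (\<sigma> - r)) / 2"
  define \<beta> where "\<beta> = \<tau> * m / 2"
  define \<gamma> where "\<gamma> = \<sigma> * \<tau> * m + (m - 2 * r * \<sigma>) * L / 2"
  have "0 < \<tau>" using pos by (simp add: \<tau>_def)
  have \<alpha>: "0 < \<alpha>" using pos by (simp add: \<alpha>_def add_pos_pos)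
  have \<beta>: "0 < \<beta>" using pos \<open>0 < \<tau>\<close> by (simp add: \<beta>_def)
  have \<gamma>: "0 < \<gamma>" using pos m_ge \<open>0 < \<tau>\<close> by (simp add: \<gamma>_def add_pos_nonneg)
  show ?thesis
  proof
    show "0 < \<alpha> + \<beta> + \<gamma>" using \<alpha> \<beta> \<gamma> by simp
    fix z :: "'a \<times> 'a"
    obtain q p where z: "z = (q, p)" by fastforce
    have "lyapunov z \<le> \<alpha> * (p \<bullet> p) + 2 * \<beta> * (p \<bullet> q) + \<sigma> * \<tau> * m * (q \<bullet> q)
        + (m - 2 * r * \<sigma>) * (L / 2 * (q \<bullet> q))"
      using mult_left_mono[OF potential_bounds(2)[of q], of "m - 2 * r * \<sigma>"] m_ge
      by (simp add: lyapunov_def z \<alpha>_def \<beta>_def \<tau>_def)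
    also have "\<dots> = \<alpha> * (p \<bullet> p) + 2 * \<beta> * (p \<bullet> q) + \<gamma> * (q \<bullet> q)"
      by (simp add: \<gamma>_def algebra_simps)
    also have "\<dots> \<le> (\<alpha> + \<beta> + \<gamma>) * (z \<bullet> z)"
      using binary_form_upper[of \<alpha> \<beta> \<gamma> p q] \<alpha> \<beta> \<gamma> by (simp add: z add.commute)
    finally show "lyapunov z \<le> (\<alpha> + \<beta> + \<gamma>) * (z \<bullet> z)" .
  qed
qed

section \<open>Exponential stability of the heavy ball system\<close>

lemma heavy_ball_exponentially_stable:
  "exponentially_stable r (heavy_ball_field \<sigma> f)"
proof -
  obtain c where c: "0 < c" "\<And>z. c * (z \<bullet> z) \<le> lyapunov z" using lyapunov_coercive by blast
  obtain K where K: "0 < K" "\<And>z. lyapunov z \<le> K * (z \<bullet> z)" using lyapunov_bounded by blast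
  \<comment> \<open>The square root of the ratio of the two comparison constants, because
    \<open>lyapunov\<close> is comparable to the squared norm.\<close>
  define \<kappa> where "\<kappa> x = sqrt (K / c) * x" for x
  have "0 < sqrt (K / c)" using c K by simp
  have bound: "norm (z T) \<le> \<kappa> (norm (z 0)) * exp (- r * T)"
    if sol: "is_solution (heavy_ball_field \<sigma> f) I z" and "0 \<in> I" "T \<in> I" "0 \<le> T" for I z T
  proof -
    \<comment> \<open>Restricting to this compact interval handles every kind of solution interval,
      whatever its endpoints.\<close>
    have sub: "{0..T} \<subseteq> I"
      using sol \<open>0 \<in> I\<close> \<open>T \<in> I\<close> interval_subset_is_interval[of I 0 T]
      by (simp add: is_solution_def)
    \<comment> \<open>The rate 2r for \<open>lyapunov\<close> becomes r for the norm once the square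
      root is taken.\<close>
    have "lyapunov (z T) \<le> lyapunov (z 0) * exp (- (2 * r) * T)"
    proof (rule exp_decay[OF \<open>0 \<le> T\<close> lyapunov_has_derivative[OF C1] lyapunov_dissipation])
      fix t assume "t \<in> {0..T}"
      with sol sub show "(z has_vector_derivative heavy_ball_field \<sigma> f (z t)) (at t within {0..T})"
        unfolding is_solution_def by (blast intro: has_vector_derivative_within_subset)
    qed
    also have "\<dots> \<le> K * (z 0 \<bullet> z 0) * exp (- (2 * r) * T)"
      using K by simp
    finally have "c * (z T \<bullet> z T) \<le> K * (z 0 \<bullet> z 0) * exp (- (2 * r) * T)"
      using c(2) order_trans by blast
    then have "(norm (z T))\<^sup>2 \<le> K / c * (norm (z 0))\<^sup>2 * (exp (- r * T))\<^sup>2"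
      using c(1) by (simp add: power2_norm_eq_inner field_simps exp_double[symmetric])
    also have "\<dots> = (\<kappa> (norm (z 0)) * exp (- r * T))\<^sup>2"
      using c K by (simp add: \<kappa>_def power_mult_distrib)
    finally show ?thesis
      by (rule power2_le_imp_le) (use c K in \<open>simp add: \<kappa>_def\<close>)
  qed
  have cont: "continuous_on UNIV (gradient f)"
    using C1 by (simp add: C1_function_def)
  have "continuous_on UNIV (heavy_ball_field \<sigma> f)"
    unfolding heavy_ball_field_def case_prod_beta
    by (intro continuous_intros continuous_on_compose2[OF cont]) auto
  moreover have "heavy_ball_field \<sigma> f 0 = 0"
    using in_sector_zero[OF sector L_pos] by (simp add: heavy_ball_field_def zero_prod_def)
  moreover have "\<kappa> \<in> {0..} \<rightarrow> {0..}" "continuous_on {0..} \<kappa>" "strict_mono_on {0..} \<kappa>" "\<kappa> 0 = 0"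
    using \<open>0 < sqrt (K / c)\<close> unfolding \<kappa>_def
    by (auto intro!: continuous_intros strict_mono_onI mult_strict_left_mono)
  ultimately show ?thesis
    using pos bound unfolding exponentially_stable_def by (intro conjI exI[of _ \<kappa>]) auto
qed

end

end

theorem theorem3:
  fixes f :: "real ^ 'd \<Rightarrow> real"
    and m L \<sigma> r :: real
  assumes "C1_function f"
    and "m > 0" and "\<sigma> > 0" and "r > 0" and "L > m"
    and "r < \<sigma>"
    and "m \<ge> 2 * r * \<sigma>"
    and "L \<le> (2 * \<sigma> - r) * m / r"
    and "in_sector m L (gradient f)"
  shows "exponentially_stable r (heavy_ball_field \<sigma> f)"
proof (rule heavy_ball_exponentially_stable)
  show "r * L \<le> (2 * \<sigma> - r) * m"
    using assms by (simp add: field_simps)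
qed (use assms in auto)

end
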